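(* For every integer $n \geq 1$, the following identity of polynomials in the indeterminate $x$ holds: $$\sum_{k=1}^n\frac{1}{n}\binom{n}{k}\binom{n}{k-1}x^{2(k-1)}(1+x)^{2(n-k)}=\sum_{k=0}^{n-1}C_{k+1}\binom{n-1}{k}x^k(1+x)^{k}.$$
   Context: $C_k=\frac{1}{k+1}\binom{2k}{k}$ denotes the $k$-th Catalan number. *)

theory Defs
  imports "HOL-Computational_Algebra.Polynomial"
begin

definition catalan :: "nat \<Rightarrow> rat" where
  "catalan k = 1 / of_nat (k + 1) * of_nat ((2 * k) choose k)"

abbreviation X :: "rat poly" where
  "X \<equiv> [:0, 1:]"

end

theory Submission
  imports Defs
begin

text \<open>
  Both sides are specialisations of the gamma expansion of the Narayana polynomials
  \[ \sum_j N(m+1,j+1)\, a^j b^{m-j} = \sum_i C_i \binom{m}{2i} (ab)^i (a+b)^{m-2i}, \]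
  which is Vandermonde's identity after comparing coefficients of \<open>a\<^sup>j b\<^sup>m\<^sup>-\<^sup>j\<close>.
  At \<open>a = b = 1\<close> it gives Touchard's identity
  \[ C_{k+1} = \sum_i C_i \binom{k}{2i} 2^{k-2i}. \]
  At \<open>a = x\<^sup>2\<close>, \<open>b = (1+x)\<^sup>2\<close> one has \<open>ab = t\<^sup>2\<close> and \<open>a + b = 1 + 2t\<close> with \<open>t = x(1+x)\<close>;
  expanding \<open>(1+2t)\<close>-powers and collecting the coefficient of \<open>t\<^sup>k\<close> by Touchard's identity
  yields the right-hand side.
\<close>

text \<open>Reversing the index by \<open>i\<close> \<mapsto> \<open>j - i\<close> and using the
  symmetry of \<open>j choose i\<close> turns the sum into a Vandermonde convolution. The bound
  \<open>j \<le> m\<close> ensures that every nonzero term lies in the range.\<close>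

lemma sum_choose_mult_choose_Suc:
  "(\<Sum>i\<le>m. (j choose i) * (k choose Suc i)) = (j + k) choose Suc j" if "j \<le> m"
proof -
  have "(\<Sum>i\<le>m. (j choose i) * (k choose Suc i)) = (\<Sum>i\<le>j. (j choose i) * (k choose Suc i))"
    using that by (intro sum.mono_neutral_right) auto
  also have "\<dots> = (\<Sum>i\<le>j. (j choose (j - i)) * (k choose Suc (j - i)))"
    by (rule sum.reindex_bij_witness[of _ "\<lambda>i. j - i" "\<lambda>i. j - i"]) auto
  also have "\<dots> = (\<Sum>i\<le>j. (j choose i) * (k choose (Suc j - i)))"
    by (intro sum.cong refl) (auto simp: Suc_diff_le simp flip: binomial_symmetric)
  also have "\<dots> = (\<Sum>i\<le>Suc j. (j choose i) * (k choose (Suc j - i)))"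
    by simp
  also have "\<dots> = (j + k) choose Suc j"
    by (rule vandermonde)
  finally show ?thesis .
qed

text \<open>Trinomial revision, (m choose k)(k choose r) = (m choose r)(m-r choose k-r), pulls out
  the factors depending only on \<open>r\<close>; the shift \<open>k = r + l\<close> leaves a
  binomial expansion. For \<open>r > m\<close> both sides vanish.\<close>

lemma sum_choose_mult_choose_power:
  fixes c t :: "'a :: comm_ring_1"
  shows "(\<Sum>k\<le>m. of_nat ((m choose k) * (k choose r)) * c ^ (k - r) * t ^ k) =
    of_nat (m choose r) * t ^ r * (1 + c * t) ^ (m - r)"
proof (cases "r \<le> m")
  case True
  have "(\<Sum>k\<le>m. of_nat ((m choose k) * (k choose r)) * c ^ (k - r) * t ^ k) =
      (\<Sum>k\<in>{r..m}. of_nat ((m choose k) * (k choose r)) * c ^ (k - r) * t ^ k)"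
    by (intro sum.mono_neutral_right) (auto simp: not_le binomial_eq_0)
  also have "\<dots> = (\<Sum>l\<le>m - r. of_nat ((m choose r) * ((m - r) choose l)) * c ^ l * t ^ (r + l))"
    by (rule sum.reindex_bij_witness[of _ "\<lambda>l. r + l" "\<lambda>k. k - r"])
      (use True in \<open>auto simp: choose_mult simp del: of_nat_mult\<close>)
  also have "\<dots> = of_nat (m choose r) * t ^ r *
      (\<Sum>l\<le>m - r. of_nat ((m - r) choose l) * (c * t) ^ l * 1 ^ (m - r - l))"
    by (simp add: sum_distrib_left power_add power_mult_distrib mult_ac)
  also have "(\<Sum>l\<le>m - r. of_nat ((m - r) choose l) * (c * t) ^ l * 1 ^ (m - r - l)) =
      (1 + c * t) ^ (m - r)"
    by (subst add.commute) (rule binomial_ring[symmetric])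
  finally show ?thesis .
qed (auto intro!: sum.neutral simp: not_le binomial_eq_0)

lemma catalan_fact: "catalan i = fact (2 * i) / (fact i * fact (Suc i))"
  by (simp add: catalan_def binomial_fact mult_2)

text \<open>With p = m - 2i - l, both sides equal m! / (i! (i+1)! l! p!). On the right, once j = i +
  l is fixed, \<open>i\<close> survives only in the two binomials, ready for Vandermonde.\<close>

lemma catalan_mult_choose:
  assumes "2 * i + l \<le> m"
  shows "catalan i * of_nat (m choose (2 * i)) * of_nat ((m - 2 * i) choose l) =
    fact m / (fact (i + l) * fact (Suc m - (i + l))) *
      of_nat (((i + l) choose i) * ((Suc m - (i + l)) choose Suc i))"
proof -
  obtain p where m: "m = 2 * i + l + p"
    using assms le_Suc_ex by blast
  have "Suc m - (i + l) = Suc (i + p)" "m - 2 * i = l + p"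
    by (auto simp: m)
  moreover have "rat_of_nat (Suc (i + p) choose Suc i) = fact (Suc (i + p)) / (fact (Suc i) * fact p)"
    by (subst binomial_fact) auto
  ultimately show ?thesis
    by (simp add: catalan_fact binomial_fact m del: fact_Suc binomial_Suc_Suc)
qed

lemma narayana_gamma_expansion:
  fixes a b :: rat
  shows "(\<Sum>j\<le>m. of_nat (Suc m choose Suc j) * of_nat (Suc m choose j) / of_nat (Suc m) *
            a ^ j * b ^ (m - j)) =
    (\<Sum>i\<le>m. catalan i * of_nat (m choose (2 * i)) * (a * b) ^ i * (a + b) ^ (m - 2 * i))"
proof -
  \<comment> \<open>\<open>G i j\<close> is the coefficient of a^j b^(m-j) in the
    \<open>i\<close>-th summand of the right-hand side; the identity then amounts to summing
    \<open>G\<close> in the two orders.\<close>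
  define G :: "nat \<Rightarrow> nat \<Rightarrow> rat" where
    "G i j = fact m / (fact j * fact (Suc m - j)) *
      of_nat ((j choose i) * ((Suc m - j) choose Suc i))" for i j
  have G_0: "G i j = 0" if "j < i \<or> j > m - i" for i j
    using that by (auto simp: G_def)
  have inner: "catalan i * of_nat (m choose (2 * i)) * (a * b) ^ i * (a + b) ^ (m - 2 * i) =
      (\<Sum>j\<le>m. G i j * a ^ j * b ^ (m - j))" for i
  proof (cases "2 * i \<le> m")
    case True
    have "(\<Sum>j\<le>m. G i j * a ^ j * b ^ (m - j)) = (\<Sum>j\<in>{i..m - i}. G i j * a ^ j * b ^ (m - j))"
      by (intro sum.mono_neutral_right) (auto simp: G_0)
    also have "\<dots> = (\<Sum>l\<le>m - 2 * i. G i (i + l) * a ^ (i + l) * b ^ (m - (i + l)))"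
      by (rule sum.reindex_bij_witness[of _ "\<lambda>l. i + l" "\<lambda>j. j - i"]) (use True in auto)
    also have "\<dots> = (\<Sum>l\<le>m - 2 * i. catalan i * of_nat (m choose (2 * i)) * (a * b) ^ i *
        (of_nat ((m - 2 * i) choose l) * a ^ l * b ^ (m - 2 * i - l)))"
    proof (intro sum.cong refl)
      fix l assume l: "l \<in> {..m - 2 * i}"
      have "m - (i + l) = i + (m - 2 * i - l)"
        using l True by auto
      then have b: "b ^ (m - (i + l)) = b ^ i * b ^ (m - 2 * i - l)"
        by (simp only: power_add)
      have "G i (i + l) = catalan i * of_nat (m choose (2 * i)) * of_nat ((m - 2 * i) choose l)"
        unfolding G_def by (rule catalan_mult_choose[symmetric]) (use l True in auto)
      then show "G i (i + l) * a ^ (i + l) * b ^ (m - (i + l)) =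
          catalan i * of_nat (m choose (2 * i)) * (a * b) ^ i *
          (of_nat ((m - 2 * i) choose l) * a ^ l * b ^ (m - 2 * i - l))"
        unfolding b by (simp only: power_add power_mult_distrib mult_ac)
    qed
    also have "\<dots> = catalan i * of_nat (m choose (2 * i)) * (a * b) ^ i * (a + b) ^ (m - 2 * i)"
      by (simp only: binomial_ring sum_distrib_left)
    finally show ?thesis ..
  next
    case False
    \<comment> \<open>For 2i > m no \<open>j\<close> satisfies both \<open>i \<le> j\<close> and
      \<open>j \<le> m - i\<close>, so the support of \<open>G i\<close> is empty, matching
      \<open>m choose (2 * i)\<close> = 0.\<close>
    then have "G i j = 0" for j
      by (intro G_0) linarith
    with False show ?thesis by simp
  qed
  have "(\<Sum>i\<le>m. G i j) =
      of_nat (Suc m choose Suc j) * of_nat (Suc m choose j) / of_nat (Suc m)" if "j \<le> m" for j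
  proof -
    have "(\<Sum>i\<le>m. G i j) = fact m / (fact j * fact (Suc m - j)) *
        of_nat (\<Sum>i\<le>m. (j choose i) * ((Suc m - j) choose Suc i))"
      by (simp only: G_def sum_distrib_left of_nat_sum)
    also have "\<dots> = fact m / (fact j * fact (Suc m - j)) * of_nat (Suc m choose Suc j)"
      using that by (subst sum_choose_mult_choose_Suc) auto
    also have "fact m / (fact j * fact (Suc m - j)) =
        of_nat (Suc m choose j) / (of_nat (Suc m) :: rat)"
      using that by (subst binomial_fact) (auto simp del: of_nat_Suc)
    finally show ?thesis by simp
  qed
  then have "(\<Sum>j\<le>m. of_nat (Suc m choose Suc j) * of_nat (Suc m choose j) / of_nat (Suc m) *
      a ^ j * b ^ (m - j)) = (\<Sum>j\<le>m. (\<Sum>i\<le>m. G i j) * a ^ j * b ^ (m - j))"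
    by (intro sum.cong refl) auto
  also have "\<dots> = (\<Sum>i\<le>m. \<Sum>j\<le>m. G i j * a ^ j * b ^ (m - j))"
    by (subst sum.swap) (simp only: sum_distrib_right)
  finally show ?thesis
    by (simp only: inner)
qed

text \<open>The symmetry j+1 \<mapsto> m-j yields a Vandermonde sum with value (2m+2 choose m);
  dividing by m+1 gives (2m+2)! / ((m+1)! (m+2)!), the factorial form of the Catalan number.\<close>

lemma catalan_Suc_narayana:
  "catalan (Suc m) =
    (\<Sum>j\<le>m. of_nat (Suc m choose Suc j) * of_nat (Suc m choose j) / of_nat (Suc m))"
proof -
  have "(\<Sum>j\<le>m. (Suc m choose j) * (Suc m choose Suc j)) =
      (\<Sum>j\<le>m. (Suc m choose j) * (Suc m choose (m - j)))"
  proof (intro sum.cong refl)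
    fix j assume "j \<in> {..m}"
    then show "(Suc m choose j) * (Suc m choose Suc j) = (Suc m choose j) * (Suc m choose (m - j))"
      using binomial_symmetric[of "Suc j" "Suc m"] by auto
  qed
  also have "\<dots> = (Suc m + Suc m) choose m"
    by (rule vandermonde)
  finally have "(\<Sum>j\<le>m. of_nat (Suc m choose Suc j) * of_nat (Suc m choose j) / of_nat (Suc m)) =
      (of_nat ((Suc m + Suc m) choose m) / of_nat (Suc m) :: rat)"
    by (simp only: sum_divide_distrib[symmetric] of_nat_mult[symmetric] of_nat_sum[symmetric]
        mult.commute)
  also have "\<dots> = catalan (Suc m)"
  proof -
    have "Suc m + Suc m - m = Suc (Suc m)" "m \<le> Suc m + Suc m"
      by auto
    then show ?thesis
      by (simp add: catalan_fact binomial_fact mult_2[of "Suc m"] fact_Suc[of m]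
          del: fact_Suc add_Suc add_Suc_right of_nat_Suc mult_Suc_right)
  qed
  finally show ?thesis ..
qed

lemma touchard:
  "catalan (Suc k) = (\<Sum>i\<le>k. catalan i * of_nat (k choose (2 * i)) * 2 ^ (k - 2 * i))"
  using narayana_gamma_expansion[of k 1 1] by (simp add: catalan_Suc_narayana)

lemma sum_catalan_gamma:
  fixes t :: rat
  shows "(\<Sum>i\<le>m. catalan i * of_nat (m choose (2 * i)) * (t * t) ^ i * (1 + 2 * t) ^ (m - 2 * i)) =
    (\<Sum>k\<le>m. catalan (Suc k) * of_nat (m choose k) * t ^ k)"
proof -
  have "(\<Sum>k\<le>m. catalan (Suc k) * of_nat (m choose k) * t ^ k) =
     (\<Sum>k\<le>m. \<Sum>i\<le>m. catalan i *
        (of_nat ((m choose k) * (k choose (2 * i))) * 2 ^ (k - 2 * i) * t ^ k))"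
  proof (intro sum.cong refl)
    fix k assume k: "k \<in> {..m}"
    \<comment> \<open>Touchard's sum is padded with zero terms from \<open>i \<le> k\<close> to
      \<open>i \<le> m\<close>, so that the range no longer depends on \<open>k\<close> and the
      summations can be swapped.\<close>
    have "catalan (Suc k) = (\<Sum>i\<le>m. catalan i * of_nat (k choose (2 * i)) * 2 ^ (k - 2 * i))"
      unfolding touchard using k by (intro sum.mono_neutral_left) auto
    then show "catalan (Suc k) * of_nat (m choose k) * t ^ k = (\<Sum>i\<le>m. catalan i *
        (of_nat ((m choose k) * (k choose (2 * i))) * 2 ^ (k - 2 * i) * t ^ k))"
      by (simp add: sum_distrib_left sum_distrib_right mult_ac)
  qed
  also have "\<dots> = (\<Sum>i\<le>m. catalan i *
      (of_nat (m choose (2 * i)) * t ^ (2 * i) * (1 + 2 * t) ^ (m - 2 * i)))"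
    by (subst sum.swap) (simp only: sum_distrib_left[symmetric] sum_choose_mult_choose_power)
  finally show ?thesis
    by (simp only: power_mult power2_eq_square mult.assoc)
qed

theorem theorem2:
  fixes n :: nat
  assumes "n \<ge> 1"
  shows "(\<Sum>k = 1..n. smult (1 / of_nat n * of_nat (n choose k) * of_nat (n choose (k - 1)))
              (X ^ (2 * (k - 1)) * (1 + X) ^ (2 * (n - k))))
       = (\<Sum>k = 0..n - 1. smult (catalan (k + 1) * of_nat ((n - 1) choose k))
              (X ^ k * (1 + X) ^ k))" (is "?L = ?R")
proof -
  obtain m where n: "n = Suc m"
    using assms by (cases n) auto
  \<comment> \<open>The gamma expansion is available for rational numbers, so the two polynomials
    are compared by evaluation; over an infinite field this determines them.\<close>
  have "poly ?L x = poly ?R x" for x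
  proof -
    define t where "t = x * (1 + x)"
    have "poly ?L x = (\<Sum>k = 1..Suc m. 1 / of_nat (Suc m) * of_nat (Suc m choose k) *
        of_nat (Suc m choose (k - 1)) * ((x ^ 2) ^ (k - 1) * ((1 + x) ^ 2) ^ (Suc m - k)))"
      by (simp add: n poly_sum power_mult del: of_nat_Suc sum.cl_ivl_Suc)
    also have "\<dots> = (\<Sum>j\<le>m. of_nat (Suc m choose Suc j) * of_nat (Suc m choose j) /
        of_nat (Suc m) * (x ^ 2) ^ j * ((1 + x) ^ 2) ^ (m - j))"
      by (rule sum.reindex_bij_witness[of _ Suc "\<lambda>k. k - 1"]) auto
    also have "\<dots> = (\<Sum>i\<le>m. catalan i * of_nat (m choose (2 * i)) *
        (x ^ 2 * (1 + x) ^ 2) ^ i * (x ^ 2 + (1 + x) ^ 2) ^ (m - 2 * i))"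
      by (rule narayana_gamma_expansion)
    also have "x ^ 2 * (1 + x) ^ 2 = t * t"
      by (simp add: t_def power2_eq_square)
    also have "x ^ 2 + (1 + x) ^ 2 = 1 + 2 * t"
      by (simp add: t_def power2_eq_square algebra_simps)
    also note sum_catalan_gamma
    also have "(\<Sum>k\<le>m. catalan (Suc k) * of_nat (m choose k) * t ^ k) = poly ?R x"
      by (simp add: n poly_sum t_def power_mult_distrib atMost_atLeast0)
    finally show ?thesis .
  qed
  then show ?thesis
    by (intro poly_eq_poly_eq_iff[THEN iffD1]) auto
qed

end
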